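(* Let $X$ be a topological space with the property $BP_3'$ in which there is a closed nowhere dense set $F\subset X$ which is homeomorphic with the Cantor set, and let $Y$ be a non-trivial Riesz space over $\mathbb R$ with order $\le$, equipped with a Hausdorff topology. Then there exists a $\mathfrak c$-dimensional linear space $L$ over $\mathbb R$ of functions from $X$ to $Y$, contained in the family of all non-Borel super quasi-continuous functions from $X$ to $Y$ plus the zero function, such that $L$ with the order defined by $f\le g$ iff $f(x)\le g(x)$ for every $x\in X$ is a Riesz space.
   Context: $\mathbb N=\{0,1,2,\dots\}$ and $\mathfrak c=2^{\aleph_0}$. A Riesz space is an ordered vector space that is also a lattice with respect to its order. Property $BP_3'$: a topological space $X$ has property $BP_3'$ if for every nowhere dense set $F\subset X$ there is a sequence $(U_m)_{m\in\mathbb N}$ of pairwise disjoint non-empty open sets such that (i') $U_m\cap F=\emptyset$ for all $m\in\mathbb N$; (ii') $F\subset\mathrm{cl}(U_m)$ for each $m\in\mathbb N$; (iii') $X\setminus(F\cup\bigcup_{m>0}U_m)\subset\mathrm{cl}(U_0)$. A function $f\colon X\to Y$ between topological spaces is super quasi-continuous if for each $x_0\in X$, each neighbourhood $W$ of $x_0$ and each neighbourhood $V$ of $f(x_0)$ there is $x\in C_f\cap W$ with $f(x)\in V$, where $C_f$ is the set of continuity points of $f$. A function is non-Borel if it is not Borel measurable, i.e. the preimage of some open set is not a Borel set. *)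

theory Defs
  imports "HOL-Analysis.Analysis" "HOL-Library.Function_Algebras"
begin

instantiation "fun" :: (type, real_vector) real_vector
begin

definition scaleR_fun_def: "r *\<^sub>R f = (\<lambda>x. r *\<^sub>R f x)"

instance
  by standard (auto simp: scaleR_fun_def plus_fun_def fun_eq_iff
      scaleR_add_right scaleR_add_left)

end

definition nowhere_dense :: "'a::topological_space set \<Rightarrow> bool"
  where "nowhere_dense A \<longleftrightarrow> interior (closure A) = {}"

primrec cantor_stage :: "nat \<Rightarrow> real set"
  where
    "cantor_stage 0 = {0..1}"
  | "cantor_stage (Suc n) =
       (\<lambda>x. x / 3) ` cantor_stage n \<union> (\<lambda>x. (x + 2) / 3) ` cantor_stage n"

definition cantor_set :: "real set"
  where "cantor_set = (\<Inter>n. cantor_stage n)"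

definition BP3' :: "'a::topological_space itself \<Rightarrow> bool"
  where "BP3' (_ :: 'a itself) \<longleftrightarrow>
    (\<forall>F::'a set. nowhere_dense F \<longrightarrow>
      (\<exists>U::nat \<Rightarrow> 'a set.
         disjoint_family U \<and> (\<forall>m. open (U m) \<and> U m \<noteq> {}) \<and>
         (\<forall>m. U m \<inter> F = {}) \<and>
         (\<forall>m. F \<subseteq> closure (U m)) \<and>
         UNIV - (F \<union> (\<Union>m\<in>{0<..}. U m)) \<subseteq> closure (U 0)))"

text \<open>The constants \<^const>\<open>isCont\<close> and \<^const>\<open>continuous\<close> require a Hausdorff domain, which is
  not assumed here, so continuity at a point is expressed through neighbourhood filters.\<close>

definition continuity_points :: "('a::topological_space \<Rightarrow> 'b::topological_space) \<Rightarrow> 'a set"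
  where "continuity_points f = {x. (f \<longlongrightarrow> f x) (nhds x)}"

text \<open>Neighbourhoods need not be open: \<open>W\<close> is a neighbourhood of \<open>x\<close> iff \<open>x \<in> interior W\<close>.\<close>

definition super_quasi_continuous ::
    "('a::topological_space \<Rightarrow> 'b::topological_space) \<Rightarrow> bool"
  where "super_quasi_continuous f \<longleftrightarrow>
    (\<forall>x\<^sub>0 W V. x\<^sub>0 \<in> interior W \<longrightarrow> f x\<^sub>0 \<in> interior V \<longrightarrow>
       (\<exists>x \<in> continuity_points f \<inter> W. f x \<in> V))"

definition ordered_vector_space_on ::
    "'a::real_vector set \<Rightarrow> ('a \<Rightarrow> 'a \<Rightarrow> bool) \<Rightarrow> bool"
  where "ordered_vector_space_on V le \<longleftrightarrow>
    subspace V \<and>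
    reflp_on V le \<and> transp_on V le \<and> antisymp_on V le \<and>
    (\<forall>x\<in>V. \<forall>y\<in>V. \<forall>z\<in>V. le x y \<longrightarrow> le (x + z) (y + z)) \<and>
    (\<forall>x\<in>V. \<forall>y\<in>V. \<forall>a\<ge>0. le x y \<longrightarrow> le (a *\<^sub>R x) (a *\<^sub>R y))"

text \<open>Suprema and infima are taken within \<open>V\<close>: for a space of functions they need not be the
  pointwise ones.\<close>

definition riesz_space_on :: "'a::real_vector set \<Rightarrow> ('a \<Rightarrow> 'a \<Rightarrow> bool) \<Rightarrow> bool"
  where "riesz_space_on V le \<longleftrightarrow>
    ordered_vector_space_on V le \<and>
    (\<forall>x\<in>V. \<forall>y\<in>V.
       (\<exists>s\<in>V. le x s \<and> le y s \<and> (\<forall>z\<in>V. le x z \<and> le y z \<longrightarrow> le s z)) \<and>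
       (\<exists>i\<in>V. le i x \<and> le i y \<and> (\<forall>z\<in>V. le z x \<and> le z y \<longrightarrow> le z i)))"

text \<open>Riesz spaces that are whole types are the types of sort
  \<open>{ordered_real_vector, lattice}\<close>.\<close>

lemma riesz_space_on_UNIV:
  "riesz_space_on (UNIV :: 'a::{ordered_real_vector, lattice} set) (\<le>)"
proof -
  have "ordered_vector_space_on (UNIV :: 'a set) (\<le>)"
    unfolding ordered_vector_space_on_def
    by (auto simp: subspace_UNIV reflp_on_def transp_on_def antisymp_on_def
        intro: scaleR_left_mono)
  moreover have "\<exists>s. x \<le> s \<and> y \<le> s \<and> (\<forall>z. x \<le> z \<and> y \<le> z \<longrightarrow> s \<le> z)" for x y :: 'a
    by (rule exI[of _ "sup x y"]) auto
  moreover have "\<exists>i. i \<le> x \<and> i \<le> y \<and> (\<forall>z. z \<le> x \<and> z \<le> y \<longrightarrow> z \<le> i)" for x y :: 'a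
    by (rule exI[of _ "inf x y"]) auto
  ultimately show ?thesis
    unfolding riesz_space_on_def by auto
qed

text \<open>The linear space \<open>L\<close> has a Hamel basis of cardinality \<open>2\<close> to the aleph-null; the library
  constant \<^const>\<open>dim\<close> is a natural number and cannot express this.\<close>

definition continuum_dimensional :: "'a::real_vector set \<Rightarrow> bool"
  where "continuum_dimensional L \<longleftrightarrow>
    (\<exists>B. independent B \<and> span B = L \<and> B \<approx> (UNIV :: nat set set))"

end

theory Submission
  imports Defs
begin

text \<open>The elements of \<open>L\<close> are the functions \<open>\<lambda>x. a (c x) *\<^sub>R e\<close>, where \<open>e > 0\<close> is fixed in
  \<open>Y\<close>, \<open>a\<close> runs through all real sequences with \<open>a 0 = 0\<close>, and \<open>c\<close> is one index map
  \<open>X \<rightarrow> \<nat>\<close>. On \<open>U m\<close> the value of \<open>c\<close> is \<open>m\<close>, so every value taken at a point of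
  \<open>F\<close> is also taken on an open set accumulating there, which gives super quasi-continuity; on \<open>F\<close>
  the fibres of \<open>c\<close> form a partition into countably many sets no proper non-empty union of
  which is Borel. As \<open>a\<close> is not constant, a non-zero element of \<open>L\<close> separates two fibres,
  hence is not Borel. Such a partition is built on the real line by a category zero-one
  law and carried to \<open>F\<close> by a Borel injection of the line into the Cantor set.\<close>

section \<open>Baire category\<close>

text \<open>Covers by countably many closed sets with empty interior give the usual notion and suit
  both subsets and Baire's theorem.\<close>

definition meagre :: "'a::topological_space set \<Rightarrow> bool"
  where "meagre A \<longleftrightarrow>
    (\<exists>\<C>. countable \<C> \<and> (\<forall>C\<in>\<C>. closed C \<and> interior C = {}) \<and> A \<subseteq> \<Union>\<C>)"

lemma meagre_subset: "meagre B \<Longrightarrow> A \<subseteq> B \<Longrightarrow> meagre A"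
  unfolding meagre_def by (meson subset_trans)

lemma meagre_closed: "closed C \<Longrightarrow> interior C = {} \<Longrightarrow> meagre C"
  unfolding meagre_def by (rule exI[of _ "{C}"]) auto

lemma meagre_empty [simp]: "meagre {}"
  by (rule meagre_closed) auto

lemma meagre_UN:
  assumes "countable I" and "\<And>i. i \<in> I \<Longrightarrow> meagre (A i)"
  shows "meagre (\<Union>i\<in>I. A i)"
proof -
  obtain \<C> where "\<And>i. i \<in> I \<Longrightarrow> countable (\<C> i) \<and>
      (\<forall>C\<in>\<C> i. closed C \<and> interior C = {}) \<and> A i \<subseteq> \<Union>(\<C> i)"
    using assms(2) unfolding meagre_def by metis
  with assms(1) show ?thesis
    unfolding meagre_def by (intro exI[of _ "\<Union>i\<in>I. \<C> i"]) (auto, blast)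
qed

lemma meagre_Un: "meagre A \<Longrightarrow> meagre B \<Longrightarrow> meagre (A \<union> B)"
  using meagre_UN[of "UNIV :: bool set" "\<lambda>b. if b then A else B"]
  by (simp add: UNIV_bool Un_commute)

lemma meagre_translation:
  fixes A :: "'a::real_normed_vector set"
  assumes "meagre A"
  shows "meagre ((+) a ` A)"
proof -
  obtain \<C> where "countable \<C>" "\<And>C. C \<in> \<C> \<Longrightarrow> closed C \<and> interior C = {}" "A \<subseteq> \<Union>\<C>"
    using assms unfolding meagre_def by blast
  moreover from this(3) have "(+) a ` A \<subseteq> \<Union>((`) ((+) a) ` \<C>)"
    by blast
  ultimately show ?thesis
    unfolding meagre_def
    by (intro exI[of _ "(`) ((+) a) ` \<C>"]) (auto simp: interior_translation closed_translation)
qed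

text \<open>Baire's theorem, applied to the complements of the covering sets: their intersection is
  dense, yet it would have to miss \<open>U\<close>.\<close>

lemma open_not_meagre:
  fixes U :: "'a::{real_normed_vector,heine_borel} set"
  assumes "open U" "U \<noteq> {}"
  shows "\<not> meagre U"
proof
  assume "meagre U"
  then obtain \<C> where \<C>: "countable \<C>" "\<And>C. C \<in> \<C> \<Longrightarrow> closed C \<and> interior C = {}" "U \<subseteq> \<Union>\<C>"
    unfolding meagre_def by blast
  have "UNIV \<subseteq> closure (\<Inter>(uminus ` \<C>))"
  proof (rule Baire)
    fix T assume "T \<in> uminus ` \<C>"
    then show "openin (top_of_set UNIV) T \<and> UNIV \<subseteq> closure T"
      using \<C>(2) by (auto simp: closure_complement)
  qed (use \<C> in auto)
  moreover have "U \<inter> \<Inter>(uminus ` \<C>) = {}"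
    using \<C>(3) by blast
  ultimately show False
    using assms open_Int_closure_eq_empty by blast
qed

section \<open>The Baire property and the category zero-one law\<close>

definition baire_property :: "'a::topological_space set \<Rightarrow> bool"
  where "baire_property A \<longleftrightarrow> (\<exists>U. open U \<and> meagre (A - U \<union> (U - A)))"

text \<open>The sets with this property form a sigma-algebra containing the open sets.\<close>

lemma borel_baire_property:
  assumes "A \<in> sets borel"
  shows "baire_property A"
proof -
  have "A \<in> sigma_sets UNIV {S. open S}"
    using assms by (simp add: borel_def)
  then show ?thesis
  proof induction
    case (Basic A)
    then show ?case
      unfolding baire_property_def by (intro exI[of _ A]) auto
  next
    case Empty
    then show ?case
      unfolding baire_property_def by (intro exI[of _ "{}"]) auto
  next
    case (Compl A)
    then obtain U where U: "open U" "meagre (A - U \<union> (U - A))"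
      unfolding baire_property_def by blast
    \<comment> \<open>The complement of \<open>A\<close> is compared with the open set
      \<open>- closure U\<close>; the extra error is the boundary of \<open>U\<close>, closed with
      empty interior.\<close>
    have "meagre (closure U - U)"
    proof (rule meagre_closed)
      show "closed (closure U - U)"
        using U(1) by (simp add: closed_Diff)
      have "interior (closure U - U) \<inter> U = {}"
        using interior_subset by blast
      then have "interior (closure U - U) \<inter> closure U = {}"
        by (simp add: open_Int_closure_eq_empty)
      then show "interior (closure U - U) = {}"
        using interior_subset by blast
    qed
    with U(2) have "meagre ((A - U \<union> (U - A)) \<union> (closure U - U))"
      by (rule meagre_Un)
    then have "meagre (UNIV - A - (- closure U) \<union> (- closure U - (UNIV - A)))"
      by (rule meagre_subset) (use closure_subset in blast)
    then show ?case
      unfolding baire_property_def by (intro exI[of _ "- closure U"]) auto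
  next
    case (Union A)
    then obtain U where U: "\<And>i. open (U i)" "\<And>i. meagre (A i - U i \<union> (U i - A i))"
      unfolding baire_property_def by metis
    have "meagre (\<Union>i. A i - U i \<union> (U i - A i))"
      using U(2) by (intro meagre_UN) auto
    then have "meagre ((\<Union>i. A i) - (\<Union>i. U i) \<union> ((\<Union>i. U i) - (\<Union>i. A i)))"
      by (rule meagre_subset) blast
    then show ?case
      unfolding baire_property_def using U(1) by (intro exI[of _ "\<Union>i. U i"]) auto
  qed
qed

text \<open>If the approximating open set is empty, \<open>A\<close> is meagre. Otherwise some
  rational shift carries any given real into it; a point outside \<open>A\<close> then lands in the
  meagre set \<open>U - A\<close>, so countably many translates of that set cover
  \<open>- A\<close>.\<close>

lemma category_zero_one_law:
  fixes A :: "real set"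
  assumes "baire_property A" and inv: "\<And>x q. x + of_rat q \<in> A \<longleftrightarrow> x \<in> A"
  shows "meagre A \<or> meagre (- A)"
proof -
  obtain U where U: "open U" "meagre (A - U \<union> (U - A))"
    using assms(1) unfolding baire_property_def by blast
  show ?thesis
  proof (cases "U = {}")
    case True
    with U(2) show ?thesis by simp
  next
    case False
    have "\<exists>q. x + of_rat q \<in> U" for x :: real
    proof -
      obtain u where "u \<in> U" using False by blast
      then obtain e where e: "e > 0" "ball u e \<subseteq> U"
        using U(1) open_contains_ball by blast
      obtain q where "u - x < of_rat q" "of_rat q < u - x + e"
        using of_rat_dense[of "u - x" "u - x + e"] e(1) by auto
      then have "x + of_rat q \<in> ball u e"
        by (auto simp: dist_real_def)
      with e(2) show ?thesis by blast
    qed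
    then have "- A \<subseteq> (\<Union>q. (+) (- of_rat q) ` (U - A))"
      using inv by (force simp: image_iff)
    moreover have "meagre (U - A)"
      using U(2) by (rule meagre_subset) blast
    then have "meagre (\<Union>q. (+) (- of_rat q :: real) ` (U - A))"
      by (intro meagre_UN meagre_translation) auto
    ultimately show ?thesis
      using meagre_subset by blast
  qed
qed

text \<open>The map sends \<open>v + q + k * \<alpha>\<close> to \<open>k\<close>, where \<open>v\<close> runs through a transversal of the
  reals modulo the group generated by the rationals and a fixed irrational \<open>\<alpha>\<close>. Its fibres are
  \<open>\<rat>\<close>-invariant, and translates of each other by multiples of \<open>\<alpha>\<close>, so none of them is meagre.\<close>

lemma ex_non_borel_partition:
  "\<exists>\<psi> :: real \<Rightarrow> nat. \<forall>M. M \<noteq> {} \<longrightarrow> M \<noteq> UNIV \<longrightarrow> \<psi> -` M \<notin> sets borel"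
proof -
  obtain \<alpha> :: real where \<alpha>: "\<alpha> \<notin> \<rat>"
    using uncountable_UNIV_real countable_rat by (metis UNIV_eq_I)
  define E where "E x y \<longleftrightarrow> (\<exists>q k. x = y + of_rat q + of_int k * \<alpha>)" for x y :: real
  have E_refl: "E x x" for x
    unfolding E_def by (intro exI[of _ 0]) simp
  have E_sym: "E y x" if "E x y" for x y
  proof -
    obtain q k where "x = y + of_rat q + of_int k * \<alpha>"
      using \<open>E x y\<close> unfolding E_def by blast
    then have "y = x + of_rat (- q) + of_int (- k) * \<alpha>"
      by (simp add: of_rat_minus)
    then show ?thesis unfolding E_def by blast
  qed
  have E_trans: "E x z" if "E x y" "E y z" for x y z
  proof -
    obtain q k where "x = y + of_rat q + of_int k * \<alpha>"
      using \<open>E x y\<close> unfolding E_def by blast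
    moreover obtain r l where "y = z + of_rat r + of_int l * \<alpha>"
      using \<open>E y z\<close> unfolding E_def by blast
    ultimately have "x = z + of_rat (r + q) + of_int (l + k) * \<alpha>"
      by (simp add: of_rat_add algebra_simps)
    then show ?thesis unfolding E_def by blast
  qed
  define rep where "rep x = (SOME y. E x y)" for x
  have rep: "E x (rep x)" for x
    unfolding rep_def by (rule someI, rule E_refl)
  have rep_eq: "rep x = rep y" if "E x y" for x y
  proof -
    have "E x z = E y z" for z
      using that E_sym E_trans by blast
    then show ?thesis by (simp add: rep_def)
  qed
  define \<phi> where "\<phi> x = (SOME k. \<exists>q. x = rep x + of_rat q + of_int k * \<alpha>)" for x
  have \<phi>: "\<exists>q. x = rep x + of_rat q + of_int (\<phi> x) * \<alpha>" for x
    unfolding \<phi>_def by (rule someI_ex) (use rep[of x] in \<open>auto simp: E_def\<close>)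
  \<comment> \<open>The coefficient of \<open>\<alpha>\<close> is unique: two different ones would
    make \<open>\<alpha>\<close> rational.\<close>
  have \<phi>_eqI: "\<phi> x = k" if "x = rep x + of_rat q + of_int k * \<alpha>" for x q k
  proof (rule ccontr)
    assume "\<phi> x \<noteq> k"
    obtain r where "x = rep x + of_rat r + of_int (\<phi> x) * \<alpha>"
      using \<phi> by blast
    with that have "of_rat (r - q) = (of_int (k - \<phi> x) :: real) * \<alpha>"
      by (simp add: of_rat_diff algebra_simps)
    then have "\<alpha> = of_rat (r - q) / of_int (k - \<phi> x)"
      using \<open>\<phi> x \<noteq> k\<close> by (simp add: field_simps)
    with \<alpha> show False by (metis Rats_divide Rats_of_int Rats_of_rat)
  qed
  have \<phi>_shift: "\<phi> (x + of_rat q + of_int k * \<alpha>) = \<phi> x + k" for x q k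
  proof -
    obtain r where r: "x = rep x + of_rat r + of_int (\<phi> x) * \<alpha>"
      using \<phi> by blast
    have "rep (x + of_rat q + of_int k * \<alpha>) = rep x"
      by (rule rep_eq) (auto simp: E_def)
    with r show ?thesis
      by (intro \<phi>_eqI[of _ "r + q"]) (simp add: of_rat_add algebra_simps)
  qed
  have \<phi>_rat: "\<phi> (x + of_rat q) = \<phi> x" for x q
    using \<phi>_shift[of x q 0] by simp
  have \<phi>_int: "\<phi> (x + of_int k * \<alpha>) = \<phi> x + k" for x k
    using \<phi>_shift[of x 0 k] by simp
  have fibre: "\<not> meagre (\<phi> -` {j})" for j
  proof
    assume "meagre (\<phi> -` {j})"
    then have "meagre (\<Union>k. (+) (of_int k * \<alpha>) ` (\<phi> -` {j}))"
      by (intro meagre_UN meagre_translation) auto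
    moreover have "x \<in> (\<Union>k. (+) (of_int k * \<alpha>) ` (\<phi> -` {j}))" for x
    proof -
      have "\<phi> (x + of_int (j - \<phi> x) * \<alpha>) = j"
        by (simp only: \<phi>_int)
      then have "x \<in> (+) (of_int (\<phi> x - j) * \<alpha>) ` (\<phi> -` {j})"
        by (intro image_eqI[of _ _ "x + of_int (j - \<phi> x) * \<alpha>"]) (auto simp: algebra_simps)
      then show ?thesis by blast
    qed
    ultimately have "meagre (UNIV :: real set)"
      by (metis UNIV_eq_I)
    then show False
      using open_not_meagre[of "UNIV :: real set"] by simp
  qed
  \<comment> \<open>The bijection \<open>int_encode\<close> renumbers the integer fibres. For proper
    non-empty \<open>M\<close>, the preimage and its complement each contain a non-meagre fibre,
    against the zero-one law.\<close>
  show ?thesis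
  proof (intro exI allI impI notI)
    fix M :: "nat set"
    assume "M \<noteq> {}" "M \<noteq> UNIV" and *: "(int_encode \<circ> \<phi>) -` M \<in> sets borel"
    then obtain m n where mn: "m \<in> M" "n \<notin> M" by blast
    let ?A = "(int_encode \<circ> \<phi>) -` M"
    have "meagre ?A \<or> meagre (- ?A)"
      by (rule category_zero_one_law[OF borel_baire_property[OF *]]) (simp add: \<phi>_rat)
    moreover have "\<phi> -` {int_decode m} \<subseteq> ?A" "\<phi> -` {int_decode n} \<subseteq> - ?A"
      using mn by auto
    ultimately show False
      using fibre meagre_subset by blast
  qed
qed

section \<open>A Borel injection of the real line into the Cantor set\<close>

text \<open>On [0,1) this is the shift of binary expansions, and the floor of \<open>2 * x\<close>
  is the first digit.\<close>

definition doubling :: "real \<Rightarrow> real" where "doubling x = frac (2 * x)"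

text \<open>Binary digits b become ternary digits 2b; on [0,1) this is a right inverse of the Cantor
  function.\<close>

definition cantor_map :: "real \<Rightarrow> real"
  where "cantor_map x = (\<Sum>i. 2 * of_int \<lfloor>2 * (doubling ^^ i) x\<rfloor> / 3 ^ Suc i)"

lemma doubling_bounds: "doubling x \<in> {0..<1}"
  by (simp add: doubling_def frac_lt_1)

lemma doubling_iterate_bounds: "x \<in> {0..<1} \<Longrightarrow> (doubling ^^ i) x \<in> {0..<1}"
  by (induction i) (use doubling_bounds in auto)

lemma digit_cases:
  fixes x :: real
  assumes "x \<in> {0..<1}"
  obtains "\<lfloor>2 * x\<rfloor> = 0" | "\<lfloor>2 * x\<rfloor> = 1"
  using assms by (cases "2 * x < 1") (auto simp: floor_eq_iff)

lemma cantor_map_summable: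
  assumes "x \<in> {0..<1}"
  shows "summable (\<lambda>i. 2 * of_int \<lfloor>2 * (doubling ^^ i) x\<rfloor> / 3 ^ Suc i :: real)"
proof (rule summable_comparison_test)
  show "summable (\<lambda>i. 2 / 3 * (1 / 3) ^ i :: real)"
    by (intro summable_mult summable_geometric) simp
  have "norm (2 * of_int \<lfloor>2 * (doubling ^^ i) x\<rfloor> / 3 ^ Suc i :: real) \<le> 2 / 3 * (1 / 3) ^ i" for i
    using digit_cases[OF doubling_iterate_bounds[OF assms, of i]]
    by cases (simp_all add: power_divide)
  then show "\<exists>N. \<forall>i\<ge>N. norm (2 * of_int \<lfloor>2 * (doubling ^^ i) x\<rfloor> / 3 ^ Suc i :: real)
      \<le> 2 / 3 * (1 / 3) ^ i"
    by blast
qed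

text \<open>Splitting off the first digit. This recursion replaces the series in the two inductions
  below.\<close>

lemma cantor_map_step:
  assumes "x \<in> {0..<1}"
  shows "cantor_map x = (2 * of_int \<lfloor>2 * x\<rfloor> + cantor_map (doubling x)) / 3"
proof -
  have "cantor_map x = 2 * of_int \<lfloor>2 * x\<rfloor> / 3
      + (\<Sum>i. 2 * of_int \<lfloor>2 * (doubling ^^ i) (doubling x)\<rfloor> / 3 ^ Suc i / 3)"
    unfolding cantor_map_def
    using suminf_split_head[OF cantor_map_summable[OF assms]]
    by (simp add: funpow_swap1 mult.commute)
  also have "(\<Sum>i. 2 * of_int \<lfloor>2 * (doubling ^^ i) (doubling x)\<rfloor> / 3 ^ Suc i / 3)
      = cantor_map (doubling x) / 3"
    unfolding cantor_map_def
    by (rule suminf_divide[OF cantor_map_summable[OF doubling_bounds]])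
  finally show ?thesis by (simp add: add_divide_distrib)
qed

lemma cantor_map_bounds:
  assumes "x \<in> {0..<1}"
  shows "cantor_map x \<in> {0..1}"
proof -
  have digit: "of_int \<lfloor>2 * (doubling ^^ i) x\<rfloor> \<in> {0..1::real}" for i
    using digit_cases[OF doubling_iterate_bounds[OF assms, of i]] by cases auto
  have "0 \<le> cantor_map x"
    unfolding cantor_map_def using digit by (intro suminf_nonneg cantor_map_summable assms) simp
  moreover have "cantor_map x \<le> (\<Sum>i. 2 / 3 * (1 / 3) ^ i)"
    unfolding cantor_map_def
  proof (rule suminf_le)
    show "summable (\<lambda>i. 2 / 3 * (1 / 3) ^ i :: real)"
      by (intro summable_mult summable_geometric) simp
    show "2 * of_int \<lfloor>2 * (doubling ^^ i) x\<rfloor> / 3 ^ Suc i \<le> 2 / 3 * (1 / 3 :: real) ^ i" for i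
      using digit[of i] by (simp add: power_divide divide_right_mono)
  qed (rule cantor_map_summable[OF assms])
  moreover have "(\<Sum>i. 2 / 3 * (1 / 3) ^ i) = (1 :: real)"
    by (subst suminf_mult) (auto simp: suminf_geometric)
  ultimately show ?thesis by simp
qed

text \<open>The first digit selects the left or right copy in the next stage; the remaining digits
  are handled by induction at \<open>doubling x\<close>.\<close>

lemma cantor_map_in_cantor_set:
  assumes "x \<in> {0..<1}"
  shows "cantor_map x \<in> cantor_set"
proof -
  have "cantor_map x \<in> cantor_stage n" for n
    using assms
  proof (induction n arbitrary: x)
    case 0
    then show ?case using cantor_map_bounds by simp
  next
    case (Suc n)
    have "cantor_map (doubling x) \<in> cantor_stage n"
      by (rule Suc.IH[OF doubling_bounds])
    with digit_cases[OF Suc.prems] show ?case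
      by cases (auto simp: cantor_map_step[OF Suc.prems] add.commute)
  qed
  then show ?thesis by (simp add: cantor_set_def)
qed

text \<open>The first digit decides whether the value lies in [0,1/3] or [2/3,1], so equal values
  have equal first digits. Removing that digit doubles the distance, and iterating bounds it by
  every power of 1/2.\<close>

lemma cantor_map_inj: "inj_on cantor_map {0..<1}"
proof (rule inj_onI)
  fix x y assume xy: "x \<in> {0..<1}" "y \<in> {0..<1}" "cantor_map x = cantor_map y"
  have "\<bar>x - y\<bar> \<le> (1 / 2) ^ n" for n
    using xy
  proof (induction n arbitrary: x y)
    case 0
    then show ?case by auto
  next
    case (Suc n)
    note step = cantor_map_step[OF Suc.prems(1)] cantor_map_step[OF Suc.prems(2)]
    have bounds: "cantor_map (doubling x) \<in> {0..1}" "cantor_map (doubling y) \<in> {0..1}"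
      by (intro cantor_map_bounds doubling_bounds)+
    have digit: "\<lfloor>2 * x\<rfloor> = \<lfloor>2 * y\<rfloor>"
      using Suc.prems(3) step bounds
      by (cases rule: digit_cases[OF Suc.prems(1)]; cases rule: digit_cases[OF Suc.prems(2)]) auto
    with Suc.prems(3) step have "cantor_map (doubling x) = cantor_map (doubling y)"
      by simp
    then have "\<bar>doubling x - doubling y\<bar> \<le> (1 / 2) ^ n"
      using Suc.IH doubling_bounds by blast
    with digit have "\<bar>2 * x - 2 * y\<bar> \<le> (1 / 2) ^ n"
      by (simp add: doubling_def frac_def)
    then show ?case unfolding power_Suc by linarith
  qed
  then have "\<bar>x - y\<bar> \<le> 0"
    by (intro LIMSEQ_le_const[OF LIMSEQ_realpow_zero[of "1/2"]]) auto
  then show "x = y" by simp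
qed

lemma cantor_map_borel_measurable [measurable]: "cantor_map \<in> borel_measurable borel"
proof -
  have [measurable]: "doubling \<in> borel_measurable borel"
    unfolding doubling_def[abs_def] frac_def by measurable
  have [measurable]: "(\<lambda>x. (doubling ^^ i) x) \<in> borel_measurable borel" for i
    by (induction i) simp_all
  show ?thesis
    unfolding cantor_map_def[abs_def] by measurable
qed

text \<open>A decreasing bijection of the line onto (0,1), leading into the domain where
  \<open>cantor_map\<close> is injective.\<close>

definition logistic :: "real \<Rightarrow> real" where "logistic x = 1 / (1 + exp x)"

lemma logistic_bounds: "logistic x \<in> {0..<1}"
  by (simp add: logistic_def add_pos_pos)

lemma logistic_inj: "inj logistic"
proof (rule injI)
  fix x y assume "logistic x = logistic y"
  then have "inverse (logistic x) = inverse (logistic y)" by simp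
  then show "x = y" by (simp add: logistic_def)
qed

lemma ex_borel_injection:
  fixes F :: "'x::topological_space set"
  assumes "F homeomorphic cantor_set"
  shows "\<exists>\<kappa> \<in> borel_measurable borel. inj (\<kappa> :: real \<Rightarrow> 'x) \<and> range \<kappa> \<subseteq> F"
proof -
  obtain g where g: "continuous_on cantor_set g" "g ` cantor_set = F" "inj_on g cantor_set"
    using assms unfolding homeomorphic_def homeomorphism_def
    by (metis inj_on_inverseI)
  define k where "k = cantor_map \<circ> logistic"
  have k: "k x \<in> cantor_set" for x
    unfolding k_def using cantor_map_in_cantor_set logistic_bounds by simp
  have "inj k"
    unfolding k_def using logistic_bounds
    by (intro comp_inj_on logistic_inj inj_on_subset[OF cantor_map_inj]) blast
  then have "inj (g \<circ> k)"
    using k by (intro comp_inj_on inj_on_subset[OF g(3)]) auto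
  moreover have "k \<in> borel_measurable borel"
    unfolding k_def logistic_def[abs_def] comp_def by measurable
  \<comment> \<open>As \<open>g\<close> is continuous only on \<open>cantor_set\<close>, the
    composition goes through the restricted Borel space.\<close>
  then have "k \<in> measurable borel (restrict_space borel cantor_set)"
    using k by (intro measurable_restrict_space2) auto
  then have "g \<circ> k \<in> borel_measurable borel"
    using borel_measurable_continuous_on_restrict[OF g(1)] by (rule measurable_comp)
  ultimately show ?thesis
    using g(2) k by (intro bexI[of _ "g \<circ> k"]) auto
qed

section \<open>The space of functions\<close>

lemma ex_index_map:
  fixes F :: "'x::topological_space set"
  assumes "BP3' TYPE('x)" "nowhere_dense F" "F homeomorphic cantor_set"
  shows "\<exists>c :: 'x \<Rightarrow> nat.
    (\<forall>x. x \<in> closure (interior (c -` {c x}))) \<and>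
    (\<forall>M. M \<noteq> {} \<longrightarrow> M \<noteq> UNIV \<longrightarrow> c -` M \<notin> sets borel)"
proof -
  obtain \<psi> :: "real \<Rightarrow> nat"
    where \<psi>: "\<And>M. M \<noteq> {} \<Longrightarrow> M \<noteq> UNIV \<Longrightarrow> \<psi> -` M \<notin> sets borel"
    using ex_non_borel_partition by blast
  obtain \<kappa> :: "real \<Rightarrow> 'x"
    where \<kappa>: "\<kappa> \<in> borel_measurable borel" "inj \<kappa>" "range \<kappa> \<subseteq> F"
    using ex_borel_injection[OF assms(3)] by blast
  obtain U :: "nat \<Rightarrow> 'x set"
    where disj: "disjoint_family U" and opn: "\<And>m. open (U m)"
      and UF: "\<And>m. U m \<inter> F = {}" and FU: "\<And>m. F \<subseteq> closure (U m)"
      and rest: "UNIV - (F \<union> (\<Union>m\<in>{0<..}. U m)) \<subseteq> closure (U 0)"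
    using assms(1)[unfolded BP3'_def, THEN spec, THEN mp, OF assms(2)] by (elim exE conjE) auto
  \<comment> \<open>On \<open>F\<close> every value is admissible, since \<open>F\<close> lies in
    the closure of each \<open>U m\<close>; there \<open>c\<close> copies \<open>\<psi>\<close>
    along \<open>\<kappa>\<close>. Points outside \<open>F\<close> and all \<open>U m\<close> get 0
    because \<open>rest\<close> puts them in the closure of \<open>U 0\<close>.\<close>
  define c where "c x = (if x \<in> F then (if x \<in> range \<kappa> then \<psi> (inv \<kappa> x) else 0)
      else if \<exists>m. x \<in> U m then (THE m. x \<in> U m) else 0)" for x
  have c_U: "c x = m" if "x \<in> U m" for x m
  proof -
    have "(THE m. x \<in> U m) = m"
      using that disj by (auto simp: disjoint_family_on_def)
    with that UF show ?thesis by (auto simp: c_def)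
  qed
  have c_\<kappa>: "c (\<kappa> t) = \<psi> t" for t
    using \<kappa>(2,3) by (auto simp: c_def inv_f_f)
  have "x \<in> closure (U (c x))" for x
  proof (cases "x \<in> F \<or> (\<exists>m. x \<in> U m)")
    case True
    then show ?thesis
      using FU[of "c x"] c_U closure_subset[of "U (c x)"] by auto
  next
    case False
    then show ?thesis
      using rest by (auto simp: c_def)
  qed
  moreover have "U m \<subseteq> interior (c -` {m})" for m
    using opn c_U by (intro interior_maximal) auto
  ultimately have "x \<in> closure (interior (c -` {c x}))" for x
    using closure_mono by blast
  moreover have "c -` M \<notin> sets borel" if "M \<noteq> {}" "M \<noteq> UNIV" for M
  proof
    assume "c -` M \<in> sets borel"
    from measurable_sets[OF \<kappa>(1) this] have "\<kappa> -` c -` M \<in> sets borel"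
      by simp
    moreover have "\<kappa> -` c -` M = \<psi> -` M"
      by (auto simp: c_\<kappa>)
    ultimately show False
      using \<psi>[OF that] by simp
  qed
  ultimately show ?thesis by blast
qed

text \<open>Arbitrarily close to \<open>x\<^sub>0\<close> there are interior points of its own
  fibre; at these the function is locally constant, hence continuous, with exactly the value at
  \<open>x\<^sub>0\<close>.\<close>

lemma super_quasi_continuous_comp_index:
  assumes "\<And>x. x \<in> closure (interior (c -` {c x}))"
  shows "super_quasi_continuous (\<lambda>x. h (c x))"
  unfolding super_quasi_continuous_def
proof (intro allI impI)
  fix x\<^sub>0 W V
  assume W: "x\<^sub>0 \<in> interior W" and V: "h (c x\<^sub>0) \<in> interior V"
  have "interior W \<inter> interior (c -` {c x\<^sub>0}) \<noteq> {}"
    using W assms[of x\<^sub>0] open_Int_closure_eq_empty[OF open_interior] by blast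
  then obtain x where x: "x \<in> interior W" "x \<in> interior (c -` {c x\<^sub>0})" by blast
  have cx: "c x = c x\<^sub>0"
    using x(2) interior_subset by fastforce
  have "\<forall>\<^sub>F z in nhds x. z \<in> interior (c -` {c x\<^sub>0})"
    using x(2) by (simp add: eventually_nhds_in_open)
  then have "\<forall>\<^sub>F z in nhds x. h (c z) = h (c x)"
    by eventually_elim (use cx interior_subset in fastforce)
  then have "x \<in> continuity_points (\<lambda>x. h (c x))"
    unfolding continuity_points_def by (simp add: tendsto_eventually)
  then show "\<exists>x \<in> continuity_points (\<lambda>x. h (c x)) \<inter> W. h (c x) \<in> V"
    using x(1) V cx interior_subset[of V] interior_subset[of W]
    by (intro bexI[of _ x]) auto
qed

section \<open>Cardinality and linear independence\<close>

lemma real_sequences_lepoll_nat_set: "(UNIV :: (nat \<Rightarrow> real) set) \<lesssim> (UNIV :: nat set set)"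
proof -
  \<comment> \<open>\<open>D a\<close> codes the rationals below each term; by density they
    determine \<open>a\<close>.\<close>
  define D :: "(nat \<Rightarrow> real) \<Rightarrow> nat set"
    where "D a = to_nat ` {(n, q). of_rat q < a n}" for a
  have "inj D"
  proof (rule injI)
    fix a b assume "D a = D b"
    then have "{(n, q). of_rat q < a n} = {(n, q). of_rat q < b n}"
      unfolding D_def by (simp add: inj_image_eq_iff)
    then have *: "of_rat q < a n \<longleftrightarrow> of_rat q < b n" for n q
      by blast
    show "a = b"
    proof
      fix n
      show "a n = b n"
        using *[of _ n] of_rat_dense[of "a n" "b n"] of_rat_dense[of "b n" "a n"]
        by (metis linorder_neqE_linordered_idom order_less_asym)
    qed
  qed
  then show ?thesis
    unfolding lepoll_def by blast
qed

text \<open>The branches \<open>{(n, s \<inter> {..<n}) | n. True}\<close> form an almost disjoint family of continuum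
  many infinite sets; their indicators are linearly independent.\<close>

definition branch :: "nat set \<Rightarrow> nat \<Rightarrow> real"
  where "branch s m = (case m of 0 \<Rightarrow> 0 | Suc j \<Rightarrow>
    (case prod_decode j of (n, p) \<Rightarrow> if p = set_encode (s \<inter> {..<n}) then 1 else 0))"

text \<open>Index 0 is kept free so that branches meet the condition \<open>a 0 = 0\<close> imposed
  on \<open>L\<close>.\<close>

lemma branch_0 [simp]: "branch s 0 = 0"
  by (simp add: branch_def)

text \<open>Beyond some level \<open>N\<close> the initial segment of \<open>s\<close> differs from
  those of all other members of \<open>T\<close>; its code at that level gives
  \<open>m\<close>.\<close>

lemma branch_separates:
  assumes "finite T"
  shows "\<exists>m. branch s m = 1 \<and> (\<forall>t\<in>T - {s}. branch t m = 0)"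
proof -
  have "\<exists>d. \<forall>t\<in>T - {s}. d t \<in> (s - t) \<union> (t - s)"
    by (intro bchoice) blast
  then obtain d where d: "\<And>t. t \<in> T - {s} \<Longrightarrow> d t \<in> (s - t) \<union> (t - s)"
    by blast
  obtain N where N: "\<And>t. t \<in> T - {s} \<Longrightarrow> d t < N"
    using assms finite_nat_set_iff_bounded[of "d ` (T - {s})"] by auto
  have "t \<inter> {..<N} \<noteq> s \<inter> {..<N}" if "t \<in> T - {s}" for t
    using d[OF that] N[OF that] by blast
  then have "set_encode (s \<inter> {..<N}) \<noteq> set_encode (t \<inter> {..<N})" if "t \<in> T - {s}" for t
    using that by (simp add: set_encode_eq) metis
  then show ?thesis
    by (intro exI[of _ "Suc (prod_encode (N, set_encode (s \<inter> {..<N})))"])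
      (simp add: branch_def)
qed

text \<open>\<open>B\<close> extends to a basis of \<open>L\<close>, whose cardinality is squeezed
  between those of \<open>B\<close> and \<open>L\<close>.\<close>

lemma continuum_dimensionalI:
  fixes L :: "'a::real_vector set"
  assumes "subspace L" "L \<lesssim> (UNIV :: nat set set)"
    and B: "independent B" "B \<subseteq> L" "(UNIV :: nat set set) \<lesssim> B"
  shows "continuum_dimensional L"
proof -
  obtain C where C: "B \<subseteq> C" "C \<subseteq> L" "independent C" "L \<subseteq> span C"
    using real_vector.maximal_independent_subset_extend[OF B(2,1)]
    by (metis dependent_raw_def span_raw_def)
  have "span C = L"
    using C(2,4) assms(1) by (metis span_subspace)
  moreover have "C \<approx> (UNIV :: nat set set)"
    using C(1,2) B(3) assms(2) by (meson lepoll_antisym lepoll_trans subset_imp_lepoll)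
  ultimately show ?thesis
    using C(3) unfolding continuum_dimensional_def by blast
qed

text \<open>The absolute value of \<open>y\<close> serves: its double dominates
  \<open>y + - y\<close>, and it vanishes only for \<open>y = 0\<close>.\<close>

lemma ex_positive_element:
  fixes y :: "'y::{ordered_real_vector, lattice}"
  assumes "y \<noteq> 0"
  shows "\<exists>e::'y. 0 \<le> e \<and> e \<noteq> 0"
proof -
  let ?e = "sup y (- y)"
  have "y + - y \<le> ?e + ?e"
    by (intro add_mono) simp_all
  then have "0 \<le> (1/2) *\<^sub>R (?e + ?e)"
    by (intro scaleR_nonneg_nonneg) simp_all
  then have "0 \<le> ?e"
    by (simp add: scaleR_add_right flip: scaleR_add_left)
  moreover have "?e \<noteq> 0"
  proof
    assume "?e = 0"
    then have "y \<le> 0" "- y \<le> 0"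
      by (metis sup_ge1, metis sup_ge2)
    with assms show False by simp
  qed
  ultimately show ?thesis by blast
qed

theorem theorem20:
  fixes F :: "'x::topological_space set"
  assumes "BP3' TYPE('x)"
    and "closed F" and "nowhere_dense F" and "F homeomorphic cantor_set"
    and "\<exists>y :: 'y::{ordered_real_vector, lattice, t2_space}. y \<noteq> 0"
  shows "\<exists>L :: ('x \<Rightarrow> 'y) set.
    subspace L \<and> continuum_dimensional L \<and>
    L \<subseteq> {f. f \<notin> borel_measurable borel \<and> super_quasi_continuous f} \<union> {0} \<and>
    riesz_space_on L (\<lambda>f g. \<forall>x. f x \<le> g x)"
proof -
  obtain e :: 'y where e: "0 \<le> e" "e \<noteq> 0"
    using assms(5) ex_positive_element by blast
  obtain c :: "'x \<Rightarrow> nat"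
    where c_closure: "\<And>x. x \<in> closure (interior (c -` {c x}))"
      and c_borel: "\<And>M. M \<noteq> {} \<Longrightarrow> M \<noteq> UNIV \<Longrightarrow> c -` M \<notin> sets borel"
    using ex_index_map[OF assms(1,3,4)] by blast
  \<comment> \<open>An empty fibre would be Borel. Surjectivity lets indices that separate sequences
    be realised by points of the space.\<close>
  have c_surj: "\<exists>x. c x = m" for m
  proof (rule ccontr)
    assume "\<nexists>x. c x = m"
    then have "c -` {m} = {}" by blast
    moreover have "{m} \<noteq> UNIV" by (metis finite.emptyI finite.insertI infinite_UNIV_nat)
    ultimately show False using c_borel[of "{m}"] by simp
  qed
  define \<Phi> :: "(nat \<Rightarrow> real) \<Rightarrow> 'x \<Rightarrow> 'y" where "\<Phi> a = (\<lambda>x. a (c x) *\<^sub>R e)" for a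
  \<comment> \<open>The condition forces the value 0 on the fibre of 0, which excludes non-zero
    constant functions; those are Borel.\<close>
  define S :: "(nat \<Rightarrow> real) set" where "S = {a. a 0 = 0}"
  define L where "L = \<Phi> ` S"
  have \<Phi>_in_L: "\<Phi> a \<in> L" if "a 0 = 0" for a
    using that by (simp add: L_def S_def)
  have L_cases: "\<exists>a. f = \<Phi> a \<and> a 0 = 0" if "f \<in> L" for f
    using that by (auto simp: L_def S_def)
  have sub: "subspace L"
  proof (rule subspaceI)
    have "0 = \<Phi> (\<lambda>_. 0)" by (simp add: \<Phi>_def fun_eq_iff)
    then show "0 \<in> L" using \<Phi>_in_L by metis
    fix f g assume "f \<in> L" "g \<in> L"
    then obtain a b where "f = \<Phi> a" "a 0 = 0" "g = \<Phi> b" "b 0 = 0"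
      using L_cases by metis
    then have "f + g = \<Phi> (\<lambda>n. a n + b n)" "(\<lambda>n. a n + b n) 0 = 0"
      by (auto simp: \<Phi>_def fun_eq_iff scaleR_add_left)
    then show "f + g \<in> L" using \<Phi>_in_L by metis
  next
    fix r f assume "f \<in> L"
    then obtain a where "f = \<Phi> a" "a 0 = 0"
      using L_cases by metis
    then have "r *\<^sub>R f = \<Phi> (\<lambda>n. r * a n)" "(\<lambda>n. r * a n) 0 = 0"
      by (auto simp: \<Phi>_def fun_eq_iff scaleR_fun_def)
    then show "r *\<^sub>R f \<in> L" using \<Phi>_in_L by metis
  qed
  have dim: "continuum_dimensional L"
  proof (rule continuum_dimensionalI[OF sub])
    have "L \<lesssim> S"
      unfolding L_def by (rule image_lepoll)
    also have "S \<lesssim> (UNIV :: (nat \<Rightarrow> real) set)"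
      by (rule subset_imp_lepoll) simp
    also note real_sequences_lepoll_nat_set
    finally show "L \<lesssim> (UNIV :: nat set set)" .
    let ?b = "\<lambda>s. \<Phi> (branch s)"
    have sep: "\<exists>x. ?b s x = e \<and> (\<forall>t\<in>T - {s}. ?b t x = 0)" if "finite T" for s T
    proof -
      obtain m where m: "branch s m = 1" "\<forall>t\<in>T - {s}. branch t m = 0"
        using branch_separates[OF \<open>finite T\<close>] by blast
      obtain x where "c x = m" using c_surj by blast
      with m show ?thesis by (intro exI[of _ x]) (simp add: \<Phi>_def)
    qed
    have "inj ?b"
    proof (rule injI, rule ccontr)
      fix s t assume "?b s = ?b t" "s \<noteq> t"
      with sep[of "{t}" s] e(2) show False by auto
    qed
    then show "(UNIV :: nat set set) \<lesssim> range ?b"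
      by (simp add: inj_on_image_eqpoll_self eqpoll_imp_lepoll eqpoll_sym)
    show "range ?b \<subseteq> L"
      using \<Phi>_in_L by auto
    show "independent (range ?b)"
    proof
      assume "dependent (range ?b)"
      then obtain V u v where V: "finite V" "V \<subseteq> range ?b" "(\<Sum>v\<in>V. u v *\<^sub>R v) = 0"
        and v: "v \<in> V" "u v \<noteq> 0"
        unfolding dependent_explicit by blast
      obtain T where T: "finite T" "V = ?b ` T"
        using finite_subset_image[OF V(1,2)] by auto
      obtain s where s: "s \<in> T" "v = ?b s"
        using v(1) T(2) by blast
      \<comment> \<open>Evaluating the linear relation at \<open>x\<close> leaves only the term of
        \<open>v\<close>, so \<open>u v *\<^sub>R e = 0\<close>.\<close>
      obtain x where x: "?b s x = e" "\<And>t. t \<in> T - {s} \<Longrightarrow> ?b t x = 0"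
        using sep[OF T(1)] by metis
      have "0 = (\<Sum>v\<in>V. u v *\<^sub>R v) x"
        using V(3) by simp
      also have "\<dots> = (\<Sum>w\<in>V. u w *\<^sub>R w x)"
        using V(1) by (induction V rule: finite_induct) (simp_all add: scaleR_fun_def)
      also have "\<dots> = u v *\<^sub>R v x + (\<Sum>w\<in>V - {v}. u w *\<^sub>R w x)"
        using V(1) v(1) by (rule sum.remove)
      also have "(\<Sum>w\<in>V - {v}. u w *\<^sub>R w x) = 0"
        using x(2) T(2) s(2) by (intro sum.neutral) fastforce
      finally show False
        using v(2) e(2) s(2) x(1) by simp
    qed
  qed
  have non_borel: "\<Phi> a \<notin> borel_measurable borel" if a: "a 0 = 0" "\<Phi> a \<noteq> 0" for a
  proof
    assume meas: "\<Phi> a \<in> borel_measurable borel"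
    obtain n where "a n *\<^sub>R e \<noteq> 0"
      using a(2) by (auto simp: \<Phi>_def fun_eq_iff)
    \<comment> \<open>The index set of values in \<open>W\<close> contains \<open>n\<close> but not
      0, so it is non-empty and proper, as \<open>c_borel\<close> requires.\<close>
    then obtain W where W: "open W" "a n *\<^sub>R e \<in> W" "0 \<notin> W"
      using t1_space by blast
    let ?M = "{m. a m *\<^sub>R e \<in> W}"
    have "n \<in> ?M" "0 \<notin> ?M"
      using W(2,3) a(1) by auto
    then have "c -` ?M \<notin> sets borel"
      by (intro c_borel) blast+
    moreover have "\<Phi> a -` W = c -` ?M"
      by (auto simp: \<Phi>_def)
    ultimately show False
      using measurable_sets[OF meas borel_open[OF W(1)]] by simp
  qed
  have "f \<notin> borel_measurable borel \<and> super_quasi_continuous f" if "f \<in> L" "f \<noteq> 0" for f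
  proof -
    obtain a where a: "f = \<Phi> a" "a 0 = 0"
      using L_cases[OF \<open>f \<in> L\<close>] by blast
    moreover have "super_quasi_continuous (\<Phi> a)"
      unfolding \<Phi>_def by (rule super_quasi_continuous_comp_index[OF c_closure])
    ultimately show ?thesis
      using non_borel \<open>f \<noteq> 0\<close> by blast
  qed
  then have incl: "L \<subseteq> {f. f \<notin> borel_measurable borel \<and> super_quasi_continuous f} \<union> {0}"
    by blast
  have mono: "r *\<^sub>R e \<le> s *\<^sub>R e" if "r \<le> s" for r s
    using that e(1) by (rule scaleR_right_mono)
  have "ordered_vector_space_on L (\<lambda>f g. \<forall>x. f x \<le> g x)"
    unfolding ordered_vector_space_on_def
    using sub by (auto simp: reflp_on_def transp_on_def antisymp_on_def fun_eq_iff scaleR_fun_def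
        intro: order_trans antisym scaleR_left_mono)
  \<comment> \<open>All values are multiples of the single element \<open>e \<ge> 0\<close>, hence
    pairwise comparable: \<open>max\<close> and \<open>min\<close> of the coefficients give
    pointwise suprema and infima, and both preserve \<open>a 0 = 0\<close>.\<close>
  moreover have "\<exists>s\<in>L. (\<forall>x. f x \<le> s x) \<and> (\<forall>x. g x \<le> s x) \<and>
      (\<forall>z\<in>L. (\<forall>x. f x \<le> z x) \<and> (\<forall>x. g x \<le> z x) \<longrightarrow> (\<forall>x. s x \<le> z x))"
    and "\<exists>i\<in>L. (\<forall>x. i x \<le> f x) \<and> (\<forall>x. i x \<le> g x) \<and>
      (\<forall>z\<in>L. (\<forall>x. z x \<le> f x) \<and> (\<forall>x. z x \<le> g x) \<longrightarrow> (\<forall>x. z x \<le> i x))"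
    if fg: "f \<in> L" "g \<in> L" for f g
  proof -
    obtain a b where ab: "f = \<Phi> a" "a 0 = 0" "g = \<Phi> b" "b 0 = 0"
      using L_cases fg by metis
    show "\<exists>s\<in>L. (\<forall>x. f x \<le> s x) \<and> (\<forall>x. g x \<le> s x) \<and>
        (\<forall>z\<in>L. (\<forall>x. f x \<le> z x) \<and> (\<forall>x. g x \<le> z x) \<longrightarrow> (\<forall>x. s x \<le> z x))"
      using ab by (intro bexI[of _ "\<Phi> (\<lambda>n. max (a n) (b n))"] \<Phi>_in_L)
        (auto simp: \<Phi>_def max_def intro: mono)
    show "\<exists>i\<in>L. (\<forall>x. i x \<le> f x) \<and> (\<forall>x. i x \<le> g x) \<and>
        (\<forall>z\<in>L. (\<forall>x. z x \<le> f x) \<and> (\<forall>x. z x \<le> g x) \<longrightarrow> (\<forall>x. z x \<le> i x))"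
      using ab by (intro bexI[of _ "\<Phi> (\<lambda>n. min (a n) (b n))"] \<Phi>_in_L)
        (auto simp: \<Phi>_def min_def intro: mono)
  qed
  ultimately have "riesz_space_on L (\<lambda>f g. \<forall>x. f x \<le> g x)"
    unfolding riesz_space_on_def by simp
  with sub dim incl show ?thesis by blast
qed

end
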